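(* Let $\Omega\subset\mathbb{R}^n$ be open and let $p:\Omega\to[1,\infty)$ be measurable with $p^+=\operatorname{ess\,sup}_{\Omega}p<\infty$. Then the mixed capacity $C_{\widetilde{\mathrm{BV}}^{p(\cdot)}}(\cdot)$ is an outer measure on $\Omega$, i.e. it vanishes on $\varnothing$, is monotone with respect to inclusion, and is countably subadditive on arbitrary subsets of $\Omega$.
   Context: $L^{p(\cdot)}(\Omega)$ is the variable exponent Lebesgue space of measurable $u:\Omega\to\mathbb{R}$ (identified when equal a.e.) with $\int_\Omega |u/\lambda|^{p(x)}dx<\infty$ for some $\lambda>0$, with Luxemburg norm $\|u\|_{p(\cdot)}=\inf\{\lambda>0:\int_\Omega|u/\lambda|^{p(x)}dx\le 1\}$; $\varrho_{p(\cdot)}(u)=\int_\Omega|u(x)|^{p(x)}dx$. $\mathrm{Lip}_{\mathrm{loc}}(\Omega)$ denotes the locally Lipschitz functions on $\Omega$. For $u\in L^{p(\cdot)}(\Omega)$ define $$\varrho_{\widetilde{\mathrm{BV}}^{p(\cdot)}}(u)=\inf\Big\{\liminf_{i\to\infty}\int_\Omega|\nabla u_i(x)|^{p(x)}dx\Big\},$$ the infimum being over all sequences $(u_i)$ in $\mathrm{Lip}_{\mathrm{loc}}(\Omega)\cap L^{p(\cdot)}(\Omega)$ with $u_i\to u$ in $L^{p(\cdot)}(\Omega)$, and $\widetilde{\mathrm{BV}}^{p(\cdot)}(\Omega)=\{u\in L^{p(\cdot)}(\Omega):\varrho_{\widetilde{\mathrm{BV}}^{p(\cdot)}}(u)<\infty\}$.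 For $E\subset\Omega$ let $\mathcal{A}_{\widetilde{\mathrm{BV}}^{p(\cdot)}}(E)$ be the set of $u\in\widetilde{\mathrm{BV}}^{p(\cdot)}(\Omega)$ with $0\le u\le1$ and $u=1$ in an open neighbourhood of $E$. The mixed capacity of $E\subset\Omega$ is $$C_{\widetilde{\mathrm{BV}}^{p(\cdot)}}(E)=\inf\{\varrho_{p(\cdot)}(u)+\varrho_{\widetilde{\mathrm{BV}}^{p(\cdot)}}(u):u\in\mathcal{A}_{\widetilde{\mathrm{BV}}^{p(\cdot)}}(E)\},$$ with $\inf\varnothing=\infty$. *)

theory Defs
  imports "HOL-Analysis.Analysis" "HOL-Probability.Essential_Supremum"
begin

text \<open>
  Functions on \<open>\<Omega>\<close> are total functions whose values outside \<open>\<Omega>\<close> play no role.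
  Elements of the variable exponent space \<open>L\<^sup>p(\<Omega>)\<close> are represented by functions instead of classes modulo null sets,
  so every pointwise condition imposed on such an element is required almost everywhere.
\<close>

definition modular :: "'a::euclidean_space set \<Rightarrow> ('a \<Rightarrow> real) \<Rightarrow> ('a \<Rightarrow> real) \<Rightarrow> ennreal" where
  "modular \<Omega> p u = (\<integral>\<^sup>+ x. ennreal (\<bar>u x\<bar> powr p x) \<partial>lebesgue_on \<Omega>)"

definition Lp_var :: "'a::euclidean_space set \<Rightarrow> ('a \<Rightarrow> real) \<Rightarrow> ('a \<Rightarrow> real) set" where
  "Lp_var \<Omega> p = {u \<in> borel_measurable (lebesgue_on \<Omega>).
     \<exists>t>0. modular \<Omega> p (\<lambda>x. u x / t) < \<infinity>}"

definition luxemburg_norm :: "'a::euclidean_space set \<Rightarrow> ('a \<Rightarrow> real) \<Rightarrow> ('a \<Rightarrow> real) \<Rightarrow> real" where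
  "luxemburg_norm \<Omega> p u = Inf {t. t > 0 \<and> modular \<Omega> p (\<lambda>x. u x / t) \<le> 1}"

definition Lip_loc :: "'a::euclidean_space set \<Rightarrow> ('a \<Rightarrow> real) set" where
  "Lip_loc \<Omega> = {u. \<forall>x\<in>\<Omega>. \<exists>r>0. \<exists>L. L-lipschitz_on (ball x r \<inter> \<Omega>) u}"

text \<open>
  The classical gradient. By Rademacher's theorem a locally Lipschitz function on an open set
  is differentiable almost everywhere, so the value \<open>0\<close> at the remaining points is immaterial.
\<close>

definition gradient :: "('a::euclidean_space \<Rightarrow> real) \<Rightarrow> 'a \<Rightarrow> 'a" where
  "gradient u x = (if \<exists>D. GDERIV u x :> D then THE D. GDERIV u x :> D else 0)"

definition mixed_BV_modular ::
  "'a::euclidean_space set \<Rightarrow> ('a \<Rightarrow> real) \<Rightarrow> ('a \<Rightarrow> real) \<Rightarrow> ennreal" where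
  "mixed_BV_modular \<Omega> p u =
     (INF v \<in> {v :: nat \<Rightarrow> 'a \<Rightarrow> real. (\<forall>i. v i \<in> Lip_loc \<Omega> \<inter> Lp_var \<Omega> p) \<and>
                (\<lambda>i. luxemburg_norm \<Omega> p (\<lambda>x. v i x - u x)) \<longlonglongrightarrow> 0}.
        liminf (\<lambda>i. modular \<Omega> p (\<lambda>x. norm (gradient (v i) x))))"

definition mixed_BV :: "'a::euclidean_space set \<Rightarrow> ('a \<Rightarrow> real) \<Rightarrow> ('a \<Rightarrow> real) set" where
  "mixed_BV \<Omega> p = {u \<in> Lp_var \<Omega> p. mixed_BV_modular \<Omega> p u < \<infinity>}"

definition mixed_admissible ::
  "'a::euclidean_space set \<Rightarrow> ('a \<Rightarrow> real) \<Rightarrow> 'a set \<Rightarrow> ('a \<Rightarrow> real) set" where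
  "mixed_admissible \<Omega> p E = {u \<in> mixed_BV \<Omega> p.
     (AE x in lebesgue_on \<Omega>. 0 \<le> u x \<and> u x \<le> 1) \<and>
     (\<exists>U. open U \<and> E \<subseteq> U \<and> U \<subseteq> \<Omega> \<and> (AE x in lebesgue_on U. u x = 1))}"

definition mixed_capacity ::
  "'a::euclidean_space set \<Rightarrow> ('a \<Rightarrow> real) \<Rightarrow> 'a set \<Rightarrow> ennreal" where
  "mixed_capacity \<Omega> p E =
     (INF u \<in> mixed_admissible \<Omega> p E. modular \<Omega> p u + mixed_BV_modular \<Omega> p u)"

end

theory Submission
  imports Defs
begin

text \<open>
  The modular \<^term>\<open>mixed_BV_modular\<close> is lower semicontinuous in \<open>L\<^sup>p\<close> and subadditive under pointwise maxima.
  Given almost optimal \<open>u\<^sub>i\<close> for \<open>E\<^sub>i\<close>, the function \<open>v = sup\<^sub>i u\<^sub>i\<close> is admissible for the union: the finite maxima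
  converge to \<open>v\<close> in \<open>L\<^sup>p\<close> by dominated convergence, with \<open>\<Sum>\<^sub>i |u\<^sub>i|\<^sup>p\<close> as a majorant, and semicontinuity does the rest.

  Subadditivity under maxima needs that locally Lipschitz functions \<open>f\<close> and \<open>g\<close> have the same gradient at almost
  every point of \<open>{f = g}\<close>. Vitali's covering theorem shows that almost every point of a set \<open>A\<close> is a point at
  which \<open>A\<close> is not porous, and at such a point of \<open>{f = g}\<close> the difference \<open>f - g\<close> is differentiable with derivative \<open>0\<close>.
\<close>

section \<open>Porous sets\<close>

text \<open>Disjoint balls inside \<open>T\<close> cover almost all of \<open>S\<close>. Replacing
  each ball by its set \<open>U\<close> still covers the part of \<open>S\<close> in the ball and
  shrinks the measure by the factor \<theta>; by disjointness the total is at most \<theta> times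
  the measure of \<open>T\<close>. The sets \<open>U\<close> are measurable covers, as
  \<open>S\<close> itself may be nonmeasurable.\<close>

lemma Vitali_density_cover:
  fixes S T :: "'a::euclidean_space set"
  assumes "0 \<le> \<theta>" and T: "open T" "T \<in> lmeasurable" "S \<subseteq> T"
    and dens: "\<And>x e. x \<in> S \<Longrightarrow> e > 0 \<Longrightarrow> \<exists>d U. 0 < d \<and> d \<le> e \<and> S \<inter> ball x d \<subseteq> U \<and>
          U \<in> lmeasurable \<and> measure lebesgue U \<le> \<theta> * measure lebesgue (ball x d)"
  obtains T' where "S \<subseteq> T'" "T' \<in> lmeasurable" "measure lebesgue T' \<le> \<theta> * measure lebesgue T"
proof -
  define good where "good x d U \<longleftrightarrow> 0 < d \<and> ball x d \<subseteq> T \<and> S \<inter> ball x d \<subseteq> U \<and>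
          U \<in> lmeasurable \<and> measure lebesgue U \<le> \<theta> * measure lebesgue (ball x d)" for x d U
  define K where "K = {i. \<exists>U. good (fst i) (snd i) U}"
  have "\<exists>i. i \<in> K \<and> x \<in> ball (fst i) (snd i) \<and> snd i < d" if "x \<in> S" "0 < d" for x d
  proof -
    obtain k where "k > 0" "ball x k \<subseteq> T"
      using T \<open>x \<in> S\<close> openE by blast
    moreover obtain r U where "0 < r" "r \<le> min k (d/2)" "S \<inter> ball x r \<subseteq> U"
        "U \<in> lmeasurable" "measure lebesgue U \<le> \<theta> * measure lebesgue (ball x r)"
      using dens[OF \<open>x \<in> S\<close>, of "min k (d/2)"] \<open>k > 0\<close> \<open>d > 0\<close> by auto
    ultimately have "good x r U" "r < d"
      using \<open>d > 0\<close> subset_ball[of r k x] by (auto simp: good_def)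
    then show ?thesis
      using \<open>0 < r\<close> by (intro exI[of _ "(x, r)"]) (auto simp: K_def)
  qed
  from Vitali_covering_theorem_balls[of S K fst snd, OF this]
  obtain C where C: "countable C" "C \<subseteq> K"
    and pw: "pairwise (\<lambda>i j. disjnt (ball (fst i) (snd i)) (ball (fst j) (snd j))) C"
    and neg: "negligible (S - (\<Union>i\<in>C. ball (fst i) (snd i)))" .
  have "\<forall>i\<in>C. \<exists>U. good (fst i) (snd i) U"
    using C by (auto simp: K_def)
  then obtain U where "\<And>i. i \<in> C \<Longrightarrow> good (fst i) (snd i) (U i)"
    by metis
  then have U: "0 < snd i" "ball (fst i) (snd i) \<subseteq> T" "S \<inter> ball (fst i) (snd i) \<subseteq> U i"
    "U i \<in> lmeasurable" "measure lebesgue (U i) \<le> \<theta> * measure lebesgue (ball (fst i) (snd i))"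
    if "i \<in> C" for i
    using that unfolding good_def by auto
  \<comment> \<open>A bound that is uniform over finite subfamilies passes to the countable union,
    and makes it measurable with finite measure.\<close>
  have fin: "measure lebesgue (\<Union>(U ` I)) \<le> \<theta> * measure lebesgue T" if "I \<subseteq> C" "finite I" for I
  proof -
    have "measure lebesgue (\<Union>(U ` I)) \<le> (\<Sum>i\<in>I. measure lebesgue (U i))"
      using that U by (intro measure_UNION_le) auto
    also have "\<dots> \<le> (\<Sum>i\<in>I. \<theta> * measure lebesgue (ball (fst i) (snd i)))"
      using that U by (intro sum_mono) auto
    also have "\<dots> = \<theta> * measure lebesgue (\<Union>i\<in>I. ball (fst i) (snd i))"
      using that pw by (subst measure_UNION') (auto simp: sum_distrib_left elim: pairwise_mono)
    also have "\<dots> \<le> \<theta> * measure lebesgue T"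
    proof (intro mult_left_mono measure_mono_fmeasurable)
      show "(\<Union>i\<in>I. ball (fst i) (snd i)) \<subseteq> T"
        using that U by blast
      show "(\<Union>i\<in>I. ball (fst i) (snd i)) \<in> sets lebesgue"
        using that by (intro sets.finite_UN) auto
    qed (use T assms in auto)
    finally show ?thesis .
  qed
  have "\<Union>(U ` C) \<in> lmeasurable" "measure lebesgue (\<Union>(U ` C)) \<le> \<theta> * measure lebesgue T"
    using fmeasurable_UN_bound[OF C(1), of U lebesgue "\<theta> * measure lebesgue T"]
      measure_UN_bound[OF C(1), of U lebesgue "\<theta> * measure lebesgue T"] U(4) fin by simp_all
  moreover define N where "N = S - (\<Union>i\<in>C. ball (fst i) (snd i))"
  moreover have "N \<in> lmeasurable" "N \<in> null_sets lebesgue"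
    using neg by (simp_all add: N_def negligible_imp_measurable negligible_iff_null_sets)
  moreover have "S \<subseteq> \<Union>(U ` C) \<union> N"
    using U(3) unfolding N_def by blast
  ultimately show thesis
    by (intro that[of "\<Union>(U ` C) \<union> N"]) (auto simp: measure_Un_null_set)
qed

text \<open>A bounded part of \<open>S\<close> with outer measure \<open>m > 0\<close> has an open
  superset of measure close to \<open>m\<close>. The covering lemma shrinks it by the factor
  \<theta> to a cover of measure below \<open>m\<close>, a contradiction.\<close>

lemma negligible_if_density_bounded:
  fixes S :: "'a::euclidean_space set"
  assumes \<theta>: "0 \<le> \<theta>" "\<theta> < 1"
    and dens: "\<And>x e. x \<in> S \<Longrightarrow> e > 0 \<Longrightarrow> \<exists>d U. 0 < d \<and> d \<le> e \<and> S \<inter> ball x d \<subseteq> U \<and>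
          U \<in> lmeasurable \<and> measure lebesgue U \<le> \<theta> * measure lebesgue (ball x d)"
  shows "negligible S"
proof -
  have bounded_case: "negligible R" if R: "R \<subseteq> S" "bounded R" for R
  proof (rule ccontr)
    assume "\<not> negligible R"
    \<comment> \<open>The infimum \<open>m\<close> of this set is the outer measure of
      \<open>R\<close>; boundedness of \<open>R\<close> makes the set nonempty.\<close>
    define Ms where "Ms = measure lebesgue ` {T. R \<subseteq> T \<and> T \<in> lmeasurable}"
    have bdd: "bdd_below Ms"
      unfolding Ms_def by (intro bdd_belowI[of _ 0]) auto
    obtain B where "R \<subseteq> cball 0 B"
      using R(2) bounded_subset_ballD[of R 0] ball_subset_cball by (metis order_trans)
    then have ne: "Ms \<noteq> {}"
      unfolding Ms_def by auto
    define m where "m = Inf Ms"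
    have m_le: "m \<le> measure lebesgue T" if "R \<subseteq> T" "T \<in> lmeasurable" for T
      unfolding m_def using that bdd by (intro cInf_lower) (auto simp: Ms_def)
    obtain e where e: "e > 0" "\<And>T. R \<subseteq> T \<Longrightarrow> T \<in> lmeasurable \<Longrightarrow> e < measure lebesgue T"
      using \<open>\<not> negligible R\<close> unfolding negligible_outer_le by (metis not_le)
    have "e \<le> m"
      unfolding m_def using ne e(2) by (intro cInf_greatest) (auto simp: Ms_def less_imp_le)
    with \<open>e > 0\<close> have "m > 0" by simp
    \<comment> \<open>One \<eta> is lost in choosing \<open>T\<close>, another in passing to the
      open set \<open>G\<close>. The value is such that \<open>\<theta> * (m + 2 * \<eta>)\<close>
      is still below \<open>m\<close>.\<close>
    define \<eta> where "\<eta> = (1 - \<theta>) * m / 2"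
    have "\<eta> > 0" using \<open>m > 0\<close> \<theta> by (simp add: \<eta>_def)
    have "Inf Ms < m + \<eta>" using \<open>\<eta> > 0\<close> m_def by simp
    then obtain T where T: "R \<subseteq> T" "T \<in> lmeasurable" "measure lebesgue T < m + \<eta>"
      using cInf_lessD[OF ne] by (auto simp: Ms_def)
    obtain G where G: "open G" "T \<subseteq> G" "G - T \<in> lmeasurable" "emeasure lebesgue (G - T) < ennreal \<eta>"
      using sets_lebesgue_outer_open[of T \<eta>] T \<open>\<eta> > 0\<close> by auto
    have "G = T \<union> (G - T)" using G by auto
    then have Gm: "G \<in> lmeasurable" using T G by (metis fmeasurable.Un)
    have "measure lebesgue G \<le> measure lebesgue T + measure lebesgue (G - T)"
      using T G \<open>G = T \<union> (G - T)\<close> measure_Un_le[of T lebesgue "G - T"] by auto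
    also have "measure lebesgue (G - T) < \<eta>"
      using G \<open>\<eta> > 0\<close> by (simp add: emeasure_eq_measure2 ennreal_less_iff)
    finally have "measure lebesgue G < m + 2 * \<eta>" using T by simp
    moreover obtain T' where "R \<subseteq> T'" "T' \<in> lmeasurable" "measure lebesgue T' \<le> \<theta> * measure lebesgue G"
    proof (rule Vitali_density_cover[OF \<theta>(1) G(1) Gm, of R])
      show "R \<subseteq> G" using T G by auto
      fix y and e :: real assume "y \<in> R" "0 < e"
      then obtain d U where "0 < d \<and> d \<le> e \<and> S \<inter> ball y d \<subseteq> U \<and>
          U \<in> lmeasurable \<and> measure lebesgue U \<le> \<theta> * measure lebesgue (ball y d)"
        using dens[of y e] R by blast
      then show "\<exists>d U. 0 < d \<and> d \<le> e \<and> R \<inter> ball y d \<subseteq> U \<and>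
          U \<in> lmeasurable \<and> measure lebesgue U \<le> \<theta> * measure lebesgue (ball y d)"
        using R by (intro exI[of _ d] exI[of _ U]) auto
    qed
    ultimately have "m \<le> \<theta> * (m + 2 * \<eta>)"
      using m_le[of T'] \<theta> by (smt (verit) mult_left_mono)
    also have "\<dots> = m - (1 - \<theta>)^2 * m"
      unfolding \<eta>_def by (simp add: field_simps power2_eq_square)
    also have "\<dots> < m" using \<open>m > 0\<close> \<theta> by simp
    finally show False by simp
  qed
  have "negligible (\<Union>n. S \<inter> cball 0 (real n))"
    by (intro negligible_countable_Union) (auto intro!: bounded_case simp: bounded_Int)
  moreover have "S \<subseteq> (\<Union>n. S \<inter> cball 0 (real n))"
    using real_arch_simple by fastforce
  ultimately show ?thesis
    using negligible_subset by blast
qed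

text \<open>At arbitrarily small scales there are holes whose radius is a fixed fraction of their
  distance from \<open>x\<close>. Without \<open>y \<noteq> x\<close> the empty ball of radius 0
  would count as a hole.\<close>

definition porous_at :: "'a::metric_space set \<Rightarrow> 'a \<Rightarrow> bool" where
  "porous_at A x \<longleftrightarrow> (\<exists>\<epsilon>>0. \<forall>\<delta>>0. \<exists>y. y \<noteq> x \<and> dist x y < \<delta> \<and> ball y (\<epsilon> * dist x y) \<inter> A = {})"

text \<open>For a fixed ratio \<epsilon>, a hole takes up the fraction
  \<open>(\<epsilon>/2)^DIM('a)\<close> of a ball around the point, so the density criterion
  applies. Countably many ratios exhaust all porous points.\<close>

lemma negligible_porous_points:
  fixes A :: "'a::euclidean_space set"
  shows "negligible {x\<in>A. porous_at A x}"
proof -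
  define P where "P \<epsilon> = {x\<in>A. \<forall>\<delta>>0. \<exists>y. y \<noteq> x \<and> dist x y < \<delta> \<and> ball y (\<epsilon> * dist x y) \<inter> A = {}}" for \<epsilon> :: real
  have neg: "negligible (P \<epsilon>)" if "0 < \<epsilon>" "\<epsilon> \<le> 1" for \<epsilon>
  proof (rule negligible_if_density_bounded[where \<theta>="1 - (\<epsilon>/2)^DIM('a)"])
    show "0 \<le> 1 - (\<epsilon>/2)^DIM('a)" "1 - (\<epsilon>/2)^DIM('a) < 1"
      using that by (auto simp: power_le_one)
    fix x and e :: real assume "x \<in> P \<epsilon>" "0 < e"
    then obtain y where y: "y \<noteq> x" "dist x y < e / 2" "ball y (\<epsilon> * dist x y) \<inter> A = {}"
      by (auto simp: P_def dest: spec[of _ "e/2"])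
    define d where "d = 2 * dist x y"
    define U where "U = ball x d - ball y (\<epsilon> * dist x y)"
    have "d > 0" using y by (simp add: d_def)
    \<comment> \<open>Since \<epsilon> is at most 1, doubling the distance gives a ball around
      \<open>x\<close> that contains the whole hole.\<close>
    have "\<epsilon> * dist x y \<le> dist x y"
      using that by (simp add: mult_left_le_one_le)
    then have sub: "ball y (\<epsilon> * dist x y) \<subseteq> ball x d"
      unfolding d_def by (smt (verit) dist_triangle dist_commute mem_ball subsetI)
    have "measure lebesgue U = measure lebesgue (ball x d) - measure lebesgue (ball y (\<epsilon> * dist x y))"
      unfolding U_def using sub by (intro measurable_measure_Diff) auto
    also have "\<epsilon> * dist x y = \<epsilon> / 2 * d" by (simp add: d_def)
    also have "measure lebesgue (ball x d) - measure lebesgue (ball y (\<epsilon> / 2 * d)) =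
        (1 - (\<epsilon>/2)^DIM('a)) * measure lebesgue (ball x d)"
      using that \<open>d > 0\<close> by (simp add: content_ball field_simps power_mult_distrib)
    finally have "measure lebesgue U \<le> (1 - (\<epsilon>/2)^DIM('a)) * measure lebesgue (ball x d)" by simp
    moreover have "P \<epsilon> \<inter> ball x d \<subseteq> U" "U \<in> lmeasurable"
      using y by (auto simp: U_def P_def)
    ultimately show "\<exists>d U. 0 < d \<and> d \<le> e \<and> P \<epsilon> \<inter> ball x d \<subseteq> U \<and> U \<in> lmeasurable \<and>
        measure lebesgue U \<le> (1 - (\<epsilon>/2)^DIM('a)) * measure lebesgue (ball x d)"
      using \<open>d > 0\<close> y by (intro exI[of _ d] exI[of _ U]) (auto simp: d_def)
  qed
  have "{x\<in>A. porous_at A x} \<subseteq> (\<Union>n. P (1 / real (Suc n)))"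
  proof
    fix x assume "x \<in> {x\<in>A. porous_at A x}"
    then obtain \<epsilon> where \<epsilon>: "x \<in> A" "\<epsilon> > 0"
      "\<And>\<delta>. \<delta> > 0 \<Longrightarrow> \<exists>y. y \<noteq> x \<and> dist x y < \<delta> \<and> ball y (\<epsilon> * dist x y) \<inter> A = {}"
      by (auto simp: porous_at_def)
    obtain n where n: "1 / real (Suc n) < \<epsilon>"
      using \<open>\<epsilon> > 0\<close> nat_approx_posE by blast
    have "ball y (1 / real (Suc n) * dist x y) \<subseteq> ball y (\<epsilon> * dist x y)" for y
      using n by (intro subset_ball mult_right_mono) auto
    then have "x \<in> P (1 / real (Suc n))"
      unfolding P_def using \<epsilon>(1,3) by (auto; metis disjoint_iff in_mono)
    then show "x \<in> (\<Union>n. P (1 / real (Suc n)))"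
      by blast
  qed
  moreover have "negligible (\<Union>n. P (1 / real (Suc n)))"
    by (intro negligible_countable_Union) (auto intro!: neg)
  ultimately show ?thesis
    using negligible_subset by blast
qed

section \<open>Locally Lipschitz functions\<close>

text \<open>By nonporosity, every \<open>y\<close> near \<open>x\<close> has a zero \<open>z\<close>
  of \<open>f - g\<close> at a distance small compared with that from \<open>x\<close> to
  \<open>y\<close>. The Lipschitz estimate between \<open>y\<close> and \<open>z\<close> then makes
  \<open>f - g\<close> of order o(|y - x|).\<close>

lemma has_derivative_if_eq_on_nonporous:
  fixes f g :: "'a::euclidean_space \<Rightarrow> real"
  assumes "open \<Omega>" and f: "f \<in> Lip_loc \<Omega>" and g: "g \<in> Lip_loc \<Omega>"
    and x: "x \<in> \<Omega>" "f x = g x" and np: "\<not> porous_at {y\<in>\<Omega>. f y = g y} x"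
    and g': "(g has_derivative g') (at x)"
  shows "(f has_derivative g') (at x)"
proof -
  define h where "h y = f y - g y" for y
  obtain r1 L1 where r1: "r1 > 0" "L1-lipschitz_on (ball x r1 \<inter> \<Omega>) f"
    using f x unfolding Lip_loc_def by blast
  obtain r2 L2 where r2: "r2 > 0" "L2-lipschitz_on (ball x r2 \<inter> \<Omega>) g"
    using g x unfolding Lip_loc_def by blast
  obtain r3 where r3: "r3 > 0" "ball x r3 \<subseteq> \<Omega>"
    using \<open>open \<Omega>\<close> x openE by blast
  define r where "r = min r3 (min r1 r2)"
  have "r > 0" using r1 r2 r3 by (simp add: r_def)
  have sub: "ball x r \<subseteq> ball x r1 \<inter> \<Omega>" "ball x r \<subseteq> ball x r2 \<inter> \<Omega>"
    using r3 unfolding r_def by (auto simp: subset_eq)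
  have hlip: "\<bar>h y - h z\<bar> \<le> (L1 + L2) * dist y z" if "y \<in> ball x r" "z \<in> ball x r" for y z
  proof -
    have "\<bar>f y - f z\<bar> \<le> L1 * dist y z" "\<bar>g y - g z\<bar> \<le> L2 * dist y z"
      using lipschitz_onD[OF r1(2), of y z] lipschitz_onD[OF r2(2), of y z] subsetD[OF sub(1)]
        subsetD[OF sub(2)] that unfolding dist_real_def by blast+
    then show ?thesis by (simp add: h_def algebra_simps)
  qed
  have L: "0 \<le> L1" "0 \<le> L2"
    using r1 r2 lipschitz_on_nonneg by blast+
  have "(h has_derivative (\<lambda>_. 0)) (at x)"
    unfolding has_derivative_at_alt
  proof (intro conjI allI impI)
    fix e :: real assume "e > 0"
    \<comment> \<open>The bound 1 keeps \<open>z\<close> within twice the distance of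
      \<open>y\<close> from \<open>x\<close>, hence in \<open>ball x r\<close>. The summand 1 in the
      denominator covers the case of vanishing Lipschitz constants.\<close>
    define \<epsilon> where "\<epsilon> = min 1 (e / (L1 + L2 + 1))"
    have "\<epsilon> > 0" using \<open>e > 0\<close> L by (simp add: \<epsilon>_def)
    then obtain \<delta> where "\<delta> > 0" and
      \<delta>: "\<And>y. y \<noteq> x \<Longrightarrow> dist x y < \<delta> \<Longrightarrow> ball y (\<epsilon> * dist x y) \<inter> {y\<in>\<Omega>. f y = g y} \<noteq> {}"
      using np unfolding porous_at_def by meson
    show "\<exists>d>0. \<forall>y. norm (y - x) < d \<longrightarrow> norm (h y - h x - 0) \<le> e * norm (y - x)"
    proof (intro exI[of _ "min \<delta> (r/2)"] conjI allI impI)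
      show "min \<delta> (r/2) > 0" using \<open>\<delta> > 0\<close> \<open>r > 0\<close> by simp
      fix y assume "norm (y - x) < min \<delta> (r/2)"
      then have y: "dist x y < \<delta>" "dist x y < r/2"
        by (auto simp: dist_norm norm_minus_commute)
      show "norm (h y - h x - 0) \<le> e * norm (y - x)"
      proof (cases "y = x")
        case False
        then obtain z where z: "dist y z < \<epsilon> * dist x y" "f z = g z"
          using \<delta>[OF False y(1)] by auto
        have "\<epsilon> * dist x y \<le> dist x y"
          using \<open>\<epsilon> > 0\<close> by (intro mult_left_le_one_le) (auto simp: \<epsilon>_def)
        then have "dist x z < r"
          using z(1) y(2) dist_triangle[of x z y] by simp
        then have "\<bar>h y - h z\<bar> \<le> (L1 + L2) * dist y z"
          using y(2) \<open>r > 0\<close> by (intro hlip) auto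
        also have "\<dots> \<le> (L1 + L2) * (\<epsilon> * dist x y)"
          using z(1) L by (intro mult_left_mono) auto
        also have "\<dots> \<le> (L1 + L2 + 1) * (\<epsilon> * dist x y)"
          using \<open>\<epsilon> > 0\<close> by (intro mult_right_mono) auto
        also have "\<dots> \<le> (L1 + L2 + 1) * (e / (L1 + L2 + 1) * dist x y)"
          using L by (intro mult_left_mono mult_right_mono) (auto simp: \<epsilon>_def)
        also have "\<dots> = e * norm (y - x)"
          using L by (simp add: dist_norm norm_minus_commute)
        finally show ?thesis using z(2) x(2) by (simp add: h_def)
      qed simp
    qed
  qed simp
  from has_derivative_add[OF this g'] show ?thesis by (simp add: h_def)
qed

lemma gradient_eqI:
  assumes "GDERIV u x :> D"
  shows "gradient u x = D"
proof -
  have "D' = D" if "GDERIV u x :> D'" for D'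
  proof -
    have "(\<lambda>h. h \<bullet> D') = (\<lambda>h. h \<bullet> D)"
      using that assms unfolding gderiv_def by (rule has_derivative_unique)
    then show ?thesis
      unfolding fun_eq_iff by (simp only: vector_eq_ldot)
  qed
  then have "(THE D. GDERIV u x :> D) = D"
    using assms by (intro the_equality)
  moreover have "\<exists>D. GDERIV u x :> D"
    using assms ..
  ultimately show ?thesis
    by (simp only: gradient_def if_True)
qed

text \<open>Since one of the two functions is differentiable at \<open>x\<close> whenever the other one is,
  Rademacher's theorem is not needed: at the remaining points both gradients have the value \<open>0\<close>.\<close>

lemma AE_gradient_eq_on_coincidence_set:
  assumes "open \<Omega>" "f \<in> Lip_loc \<Omega>" "g \<in> Lip_loc \<Omega>"
  shows "AE x in lebesgue_on \<Omega>. f x = g x \<longrightarrow> gradient f x = gradient g x"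
proof -
  define A where "A = {y\<in>\<Omega>. f y = g y}"
  have A': "A = {y\<in>\<Omega>. g y = f y}" by (auto simp: A_def)
  have "AE x in lebesgue. x \<notin> {x\<in>A. porous_at A x}"
    using negligible_porous_points[of A] by (intro AE_not_in) (simp add: negligible_iff_null_sets)
  then have "AE x in lebesgue. x \<in> \<Omega> \<longrightarrow> f x = g x \<longrightarrow> gradient f x = gradient g x"
  proof (rule AE_mp, intro AE_I2 impI)
    fix x assume x: "x \<notin> {x\<in>A. porous_at A x}" "x \<in> \<Omega>" "f x = g x"
    then have "\<not> porous_at A x" by (auto simp: A_def)
    \<comment> \<open>Equality as predicates on the gradient vector: the coincidence set is
      symmetric in \<open>f\<close> and \<open>g\<close>, so derivatives transfer both ways.\<close>
    then have "gderiv f x = gderiv g x"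
      using has_derivative_if_eq_on_nonporous[OF assms x(2,3)]
        has_derivative_if_eq_on_nonporous[OF assms(1,3,2) x(2)] x(3)
      unfolding gderiv_def[abs_def] A_def[symmetric] A'[symmetric] by metis
    then show "gradient f x = gradient g x"
      unfolding gradient_def by auto
  qed
  then show ?thesis
    using assms(1) by (subst AE_restrict_space_iff) auto
qed

section \<open>Maxima of locally Lipschitz functions and splitting of integrals\<close>

lemma lipschitz_on_max:
  fixes f g :: "'a::metric_space \<Rightarrow> real"
  assumes "L-lipschitz_on A f" "K-lipschitz_on A g"
  shows "(max L K)-lipschitz_on A (\<lambda>x. max (f x) (g x))"
proof (rule lipschitz_onI)
  fix x y assume xy: "x \<in> A" "y \<in> A"
  have "\<bar>f x - f y\<bar> \<le> L * dist x y" "\<bar>g x - g y\<bar> \<le> K * dist x y"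
    using lipschitz_onD[OF assms(1) xy] lipschitz_onD[OF assms(2) xy] by (auto simp: dist_real_def)
  moreover have "L * dist x y \<le> max L K * dist x y" "K * dist x y \<le> max L K * dist x y"
    by (auto intro: mult_right_mono)
  ultimately show "dist (max (f x) (g x)) (max (f y) (g y)) \<le> max L K * dist x y"
    unfolding dist_real_def by linarith
qed (use lipschitz_on_nonneg[OF assms(1)] in simp)

lemma Lip_loc_max:
  assumes "u \<in> Lip_loc \<Omega>" "v \<in> Lip_loc \<Omega>"
  shows "(\<lambda>x. max (u x) (v x)) \<in> Lip_loc \<Omega>"
  unfolding Lip_loc_def
proof (safe)
  fix x assume "x \<in> \<Omega>"
  then obtain r L s K where *: "r > 0" "L-lipschitz_on (ball x r \<inter> \<Omega>) u"
    "s > 0" "K-lipschitz_on (ball x s \<inter> \<Omega>) v"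
    using assms unfolding Lip_loc_def by blast
  have "ball x (min r s) \<inter> \<Omega> \<subseteq> ball x r \<inter> \<Omega>" "ball x (min r s) \<inter> \<Omega> \<subseteq> ball x s \<inter> \<Omega>"
    by auto
  then have "(max L K)-lipschitz_on (ball x (min r s) \<inter> \<Omega>) (\<lambda>x. max (u x) (v x))"
    using * by (intro lipschitz_on_max) (auto intro: lipschitz_on_subset)
  then show "\<exists>r>0. \<exists>L. L-lipschitz_on (ball x r \<inter> \<Omega>) (\<lambda>x. max (u x) (v x))"
    using * by (intro exI[of _ "min r s"]) auto
qed

text \<open>The functions need not be measurable, so that additivity of the integral is not available:
  \<^term>\<open>integral\<^sup>N\<close> is then a lower integral.\<close>

lemma nn_integral_le_split:
  assumes A: "A \<in> sets M"
    and "AE x in M. x \<in> A \<longrightarrow> f x \<le> g x" "AE x in M. x \<notin> A \<longrightarrow> f x \<le> h x"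
  shows "(\<integral>\<^sup>+x. f x \<partial>M) \<le> (\<integral>\<^sup>+x. g x \<partial>M) + (\<integral>\<^sup>+x. h x \<partial>M)"
proof -
  have "(\<integral>\<^sup>+x. f x \<partial>M) \<le> (\<integral>\<^sup>+x. (if x \<in> A then g x else h x) \<partial>M)"
    using assms by (intro nn_integral_mono_AE) auto
  also have "\<dots> \<le> (\<integral>\<^sup>+x. g x \<partial>M) + (\<integral>\<^sup>+x. h x \<partial>M)"
    \<comment> \<open>The integral is a supremum over simple functions below the integrand. These
      are measurable, so their integrals do split along \<open>A\<close>.\<close>
    unfolding nn_integral_def[of M "\<lambda>x. if x \<in> A then g x else h x"]
  proof (safe intro!: SUP_least)
    fix s assume s: "simple_function M s" and le: "s \<le> (\<lambda>x. if x \<in> A then g x else h x)"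
    have [measurable]: "s \<in> borel_measurable M"
      using s by (rule borel_measurable_simple_function)
    have "integral\<^sup>S M s = (\<integral>\<^sup>+x. s x * indicator A x + s x * indicator (space M - A) x \<partial>M)"
      using s by (subst nn_integral_eq_simple_integral[symmetric])
        (auto intro!: nn_integral_cong simp: indicator_def)
    also have "\<dots> = (\<integral>\<^sup>+x. s x * indicator A x \<partial>M) + (\<integral>\<^sup>+x. s x * indicator (space M - A) x \<partial>M)"
      using A by (intro nn_integral_add) auto
    also have "\<dots> \<le> (\<integral>\<^sup>+x. g x \<partial>M) + (\<integral>\<^sup>+x. h x \<partial>M)"
      using le by (intro add_mono nn_integral_mono) (auto simp: indicator_def le_fun_def split: if_splits)
    finally show "integral\<^sup>S M s \<le> (\<integral>\<^sup>+x. g x \<partial>M) + (\<integral>\<^sup>+x. h x \<partial>M)" .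
  qed
  finally show ?thesis .
qed

section \<open>The modulars\<close>

lemma ennreal_less_add:
  fixes a :: ennreal
  assumes "a < \<infinity>" "0 < e"
  shows "a < a + ennreal e"
  using assms ennreal_add_left_cancel_less[of a 0 "ennreal e"] by auto

lemma ennreal_le_suminf: "f i \<le> (\<Sum>i. f i :: ennreal)"
  using sum_le_suminf[of f "{i}"] by simp

text \<open>The finite bound \<open>P\<close> for the exponent makes scaling a function cost only a
  finite factor in the modular. Hence convergence in norm and in modular are equivalent.\<close>

locale bounded_exponent =
  fixes \<Omega> :: "'a::euclidean_space set" and p :: "'a \<Rightarrow> real" and P :: real
  assumes open_\<Omega>: "open \<Omega>"
    and p_measurable [measurable]: "p \<in> borel_measurable (lebesgue_on \<Omega>)"
    and p_ge_1: "x \<in> \<Omega> \<Longrightarrow> 1 \<le> p x"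
    and p_le: "AE x in lebesgue_on \<Omega>. p x \<le> P"
    and P_ge_1: "1 \<le> P"
begin

abbreviation "M \<equiv> lebesgue_on \<Omega>"
abbreviation "\<rho> \<equiv> modular \<Omega> p"
abbreviation "Dirichlet u \<equiv> \<rho> (\<lambda>x. norm (gradient u x))"

section \<open>Scaling and addition under the variable exponent modular\<close>

lemma AE_exponent: "AE x in M. 1 \<le> p x \<and> p x \<le> P"
  using p_le AE_space[of M] by eventually_elim (auto simp: p_ge_1)

lemma modular_mono:
  assumes "AE x in M. \<bar>u x\<bar> \<le> \<bar>v x\<bar>"
  shows "\<rho> u \<le> \<rho> v"
  unfolding modular_def
proof (rule nn_integral_mono_AE)
  show "AE x in M. ennreal (\<bar>u x\<bar> powr p x) \<le> ennreal (\<bar>v x\<bar> powr p x)"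
    using assms AE_exponent by eventually_elim (auto intro!: ennreal_leI powr_mono2)
qed

text \<open>Common form of the two scaling bounds below: \<open>c\<close> is \<open>t\<close> for
  \<open>t \<le> 1\<close> and \<open>t powr P\<close> for \<open>t \<ge> 1\<close>.\<close>

lemma modular_scale_le:
  assumes [measurable]: "u \<in> borel_measurable M" and "0 \<le> c"
    and c: "\<And>q. 1 \<le> q \<Longrightarrow> q \<le> P \<Longrightarrow> t powr q \<le> c" and "0 < t"
  shows "\<rho> (\<lambda>x. t * u x) \<le> ennreal c * \<rho> u"
proof -
  have "\<rho> (\<lambda>x. t * u x) \<le> (\<integral>\<^sup>+x. ennreal c * ennreal (\<bar>u x\<bar> powr p x) \<partial>M)"
    unfolding modular_def
  proof (rule nn_integral_mono_AE)
    show "AE x in M. ennreal (\<bar>t * u x\<bar> powr p x) \<le> ennreal c * ennreal (\<bar>u x\<bar> powr p x)"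
      using AE_exponent
    proof eventually_elim
      case (elim x)
      have "\<bar>t * u x\<bar> powr p x = t powr p x * \<bar>u x\<bar> powr p x"
        using \<open>0 < t\<close> by (simp add: abs_mult powr_mult)
      also have "\<dots> \<le> c * \<bar>u x\<bar> powr p x"
        using elim c by (intro mult_right_mono) auto
      finally show ?case
        using \<open>0 \<le> c\<close> by (simp add: ennreal_mult[symmetric] ennreal_leI)
    qed
  qed
  also have "\<dots> = ennreal c * \<rho> u"
    unfolding modular_def by (intro nn_integral_cmult) measurable
  finally show ?thesis .
qed

lemma modular_scale_small:
  assumes "u \<in> borel_measurable M" "0 < t" "t \<le> 1"
  shows "\<rho> (\<lambda>x. t * u x) \<le> ennreal t * \<rho> u"
proof (rule modular_scale_le)
  fix q :: real assume "1 \<le> q"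
  then show "t powr q \<le> t"
    using assms powr_mono'[of 1 q t] by simp
qed (use assms in auto)

lemma modular_scale_large:
  assumes "u \<in> borel_measurable M" "1 \<le> t"
  shows "\<rho> (\<lambda>x. t * u x) \<le> ennreal (t powr P) * \<rho> u"
  by (rule modular_scale_le) (use assms in \<open>auto intro: powr_mono\<close>)

text \<open>Pointwise, the sum is at most twice the larger absolute value; the exponent bound makes
  the factor independent of \<open>x\<close>.\<close>

lemma modular_add_le:
  assumes [measurable]: "u \<in> borel_measurable M" "v \<in> borel_measurable M"
  shows "\<rho> (\<lambda>x. u x + v x) \<le> ennreal (2 powr P) * (\<rho> u + \<rho> v)"
proof -
  have "\<rho> (\<lambda>x. u x + v x) \<le> (\<integral>\<^sup>+x. ennreal (2 powr P) * (ennreal (\<bar>u x\<bar> powr p x) + ennreal (\<bar>v x\<bar> powr p x)) \<partial>M)"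
    unfolding modular_def
  proof (rule nn_integral_mono_AE)
    show "AE x in M. ennreal (\<bar>u x + v x\<bar> powr p x) \<le>
        ennreal (2 powr P) * (ennreal (\<bar>u x\<bar> powr p x) + ennreal (\<bar>v x\<bar> powr p x))"
      using AE_exponent
    proof eventually_elim
      case (elim x)
      have "\<bar>u x + v x\<bar> powr p x \<le> (2 * max \<bar>u x\<bar> \<bar>v x\<bar>) powr p x"
        using elim by (intro powr_mono2) auto
      also have "\<dots> = 2 powr p x * max \<bar>u x\<bar> \<bar>v x\<bar> powr p x"
        by (simp add: powr_mult)
      also have "\<dots> \<le> 2 powr P * (\<bar>u x\<bar> powr p x + \<bar>v x\<bar> powr p x)"
        using elim by (intro mult_mono powr_mono) (auto simp: max_def)
      finally show ?case
        by (simp add: ennreal_mult[symmetric] ennreal_plus[symmetric] ennreal_leI del: ennreal_plus)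
    qed
  qed
  also have "\<dots> = ennreal (2 powr P) * (\<rho> u + \<rho> v)"
    unfolding modular_def by (subst nn_integral_cmult nn_integral_add, measurable)+
  finally show ?thesis .
qed

lemma Lp_var_iff: "u \<in> Lp_var \<Omega> p \<longleftrightarrow> u \<in> borel_measurable M \<and> \<rho> u < \<infinity>"
proof
  assume "u \<in> Lp_var \<Omega> p"
  then obtain t where [measurable]: "u \<in> borel_measurable M" and t: "t > 0" "\<rho> (\<lambda>x. u x / t) < \<infinity>"
    unfolding Lp_var_def by blast
  \<comment> \<open>A divisor of at least 1 puts the scaling in the range of
    \<open>modular_scale_large\<close>, and enlarging \<open>t\<close> only lowers the
    modular.\<close>
  define s where "s = max 1 t"
  have "\<rho> u = \<rho> (\<lambda>x. s * (u x / s))"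
    by (simp add: s_def)
  also have "\<dots> \<le> ennreal (s powr P) * \<rho> (\<lambda>x. u x / s)"
    by (rule modular_scale_large) (auto simp: s_def)
  also have "\<rho> (\<lambda>x. u x / s) \<le> \<rho> (\<lambda>x. u x / t)"
    using t(1) by (intro modular_mono) (auto simp: s_def abs_divide intro!: divide_left_mono)
  finally show "u \<in> borel_measurable M \<and> \<rho> u < \<infinity>"
    using t(2) by (auto simp: ennreal_mult_less_top mult_left_mono intro: le_less_trans)
next
  assume "u \<in> borel_measurable M \<and> \<rho> u < \<infinity>"
  then show "u \<in> Lp_var \<Omega> p"
    unfolding Lp_var_def by (auto intro!: exI[of _ 1])
qed

lemma modular_minus: "\<rho> (\<lambda>x. - u x) = \<rho> u"
  by (simp add: modular_def)

lemma Lp_var_diff: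
  assumes "u \<in> Lp_var \<Omega> p" "v \<in> Lp_var \<Omega> p"
  shows "(\<lambda>x. u x - v x) \<in> Lp_var \<Omega> p"
proof -
  have "\<rho> (\<lambda>x. u x + - v x) \<le> ennreal (2 powr P) * (\<rho> u + \<rho> (\<lambda>x. - v x))"
    using assms by (intro modular_add_le) (auto simp: Lp_var_iff)
  also have "\<dots> < \<infinity>"
    using assms by (auto simp: Lp_var_iff modular_minus ennreal_mult_less_top)
  finally show ?thesis
    using assms by (auto simp: Lp_var_iff)
qed

lemma Lp_var_max:
  assumes "u \<in> Lp_var \<Omega> p" "v \<in> Lp_var \<Omega> p"
  shows "(\<lambda>x. max (u x) (v x)) \<in> Lp_var \<Omega> p"
proof -
  have [measurable]: "u \<in> borel_measurable M" "v \<in> borel_measurable M"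
    using assms by (auto simp: Lp_var_iff)
  have "\<rho> (\<lambda>x. max (u x) (v x)) \<le> \<rho> (\<lambda>x. \<bar>u x\<bar> + \<bar>v x\<bar>)"
    by (intro modular_mono) auto
  also have "\<dots> \<le> ennreal (2 powr P) * (\<rho> (\<lambda>x. \<bar>u x\<bar>) + \<rho> (\<lambda>x. \<bar>v x\<bar>))"
    by (intro modular_add_le) measurable
  also have "\<dots> = ennreal (2 powr P) * (\<rho> u + \<rho> v)"
    by (simp add: modular_def)
  also have "\<dots> < \<infinity>"
    using assms by (auto simp: Lp_var_iff ennreal_mult_less_top)
  finally show ?thesis
    by (simp add: Lp_var_iff)
qed

section \<open>Comparison of Luxemburg norm and modular\<close>

text \<open>If the modular is \<open>r\<close>, dividing by \<open>r + 1\<close> brings it down to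
  at most \<open>r / (r + 1)\<close>. Nonemptiness matters because \<open>Inf\<close> of the empty
  set of reals carries no information.\<close>

lemma
  assumes "u \<in> Lp_var \<Omega> p"
  shows luxemburg_set_nonempty: "{t. t > 0 \<and> \<rho> (\<lambda>x. u x / t) \<le> 1} \<noteq> {}"
    and luxemburg_norm_nonneg: "0 \<le> luxemburg_norm \<Omega> p u"
proof -
  define r where "r = enn2real (\<rho> u)"
  have r: "\<rho> u = ennreal r" "r \<ge> 0"
    using assms by (auto simp: Lp_var_iff r_def)
  have "\<rho> (\<lambda>x. 1 / (r + 1) * u x) \<le> ennreal (1 / (r + 1)) * \<rho> u"
    using assms r by (intro modular_scale_small) (auto simp: Lp_var_iff)
  also have "\<dots> \<le> ennreal 1"
    using r by (auto simp: ennreal_mult[symmetric] divide_simps simp del: ennreal_1 intro!: ennreal_leI)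
  finally have "r + 1 \<in> {t. t > 0 \<and> \<rho> (\<lambda>x. u x / t) \<le> 1}"
    using r by simp
  then show ne: "{t. t > 0 \<and> \<rho> (\<lambda>x. u x / t) \<le> 1} \<noteq> {}"
    by blast
  then show "0 \<le> luxemburg_norm \<Omega> p u"
    unfolding luxemburg_norm_def by (intro cInf_greatest) auto
qed

text \<open>Some competitor \<open>t < \<delta>\<close> in the norm is at most 1, and scaling by
  such a \<open>t\<close> multiplies the modular by at most \<open>t\<close>.\<close>

lemma modular_le_of_luxemburg_norm_less:
  assumes u: "u \<in> Lp_var \<Omega> p" and "luxemburg_norm \<Omega> p u < \<delta>" "\<delta> \<le> 1"
  shows "\<rho> u \<le> ennreal \<delta>"
proof -
  obtain t where t: "t > 0" "\<rho> (\<lambda>x. u x / t) \<le> 1" "t < \<delta>"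
    using cInf_lessD[OF luxemburg_set_nonempty[OF u], of \<delta>] assms(2) unfolding luxemburg_norm_def by auto
  have "\<rho> u = \<rho> (\<lambda>x. t * (u x / t))"
    using t by simp
  also have "\<dots> \<le> ennreal t * \<rho> (\<lambda>x. u x / t)"
    using t assms by (intro modular_scale_small) (auto simp: Lp_var_iff)
  also have "\<dots> \<le> ennreal \<delta> * 1"
    using t by (intro mult_mono) (auto intro: ennreal_leI)
  finally show ?thesis by simp
qed

text \<open>The hypothesis on the modular exactly compensates the factor
  \<open>(1 / \<delta>) powr P\<close> that arises when dividing by \<delta>.\<close>

lemma luxemburg_norm_le_of_modular_le:
  assumes u: "u \<in> borel_measurable M" and "\<rho> u \<le> ennreal (\<delta> powr P)" "0 < \<delta>" "\<delta> \<le> 1"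
  shows "luxemburg_norm \<Omega> p u \<le> \<delta>"
proof -
  have "\<rho> (\<lambda>x. 1 / \<delta> * u x) \<le> ennreal ((1 / \<delta>) powr P) * \<rho> u"
    using assms by (intro modular_scale_large) auto
  also have "\<dots> \<le> ennreal ((1 / \<delta>) powr P) * ennreal (\<delta> powr P)"
    using assms by (intro mult_left_mono) auto
  also have "\<dots> = 1"
    using \<open>0 < \<delta>\<close> by (simp add: ennreal_mult[symmetric] powr_mult[symmetric] del: powr_one_eq_one) simp
  finally have "\<rho> (\<lambda>x. u x / \<delta>) \<le> 1"
    by simp
  then show ?thesis
    unfolding luxemburg_norm_def using \<open>0 < \<delta>\<close>
    by (intro cInf_lower bdd_belowI[of _ 0]) auto
qed

section \<open>The relaxed gradient modular: approximation, maxima, semicontinuity\<close>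

text \<open>Replaces sequences and norms in the definition by a single approximant, close in
  modular, for each tolerance. Tolerances \<open>(1 / Suc n) powr P\<close> give norms of at most
  \<open>1 / Suc n\<close>.\<close>

lemma mixed_BV_modular_leI:
  assumes u: "u \<in> Lp_var \<Omega> p"
    and approx: "\<And>\<epsilon>. \<epsilon> > 0 \<Longrightarrow> \<exists>w. w \<in> Lip_loc \<Omega> \<inter> Lp_var \<Omega> p \<and>
      \<rho> (\<lambda>x. w x - u x) \<le> ennreal \<epsilon> \<and> Dirichlet w \<le> S + ennreal \<epsilon>"
  shows "mixed_BV_modular \<Omega> p u \<le> S"
proof -
  have "\<exists>w. w \<in> Lip_loc \<Omega> \<inter> Lp_var \<Omega> p \<and>
      \<rho> (\<lambda>x. w x - u x) \<le> ennreal ((1 / real (Suc n)) powr P) \<and>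
      Dirichlet w \<le> S + ennreal ((1 / real (Suc n)) powr P)" for n
    by (rule approx) simp
  then obtain w where w: "\<And>n. w n \<in> Lip_loc \<Omega> \<inter> Lp_var \<Omega> p"
    "\<And>n. \<rho> (\<lambda>x. w n x - u x) \<le> ennreal ((1 / real (Suc n)) powr P)"
    "\<And>n. Dirichlet (w n) \<le> S + ennreal ((1 / real (Suc n)) powr P)"
    by metis
  have diff: "(\<lambda>x. w n x - u x) \<in> Lp_var \<Omega> p" for n
    using w(1) u by (auto intro: Lp_var_diff)
  have lim0: "(\<lambda>n. 1 / real (Suc n)) \<longlonglongrightarrow> 0"
    using LIMSEQ_inverse_real_of_nat by (simp add: inverse_eq_divide)
  have "(\<lambda>n. luxemburg_norm \<Omega> p (\<lambda>x. w n x - u x)) \<longlonglongrightarrow> 0"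
  proof (rule tendsto_sandwich[OF _ _ tendsto_const lim0])
    show "\<forall>\<^sub>F n in sequentially. 0 \<le> luxemburg_norm \<Omega> p (\<lambda>x. w n x - u x)"
      using luxemburg_norm_nonneg[OF diff] by simp
    show "\<forall>\<^sub>F n in sequentially. luxemburg_norm \<Omega> p (\<lambda>x. w n x - u x) \<le> 1 / real (Suc n)"
      using w(2) diff by (intro always_eventually allI luxemburg_norm_le_of_modular_le) (auto simp: Lp_var_iff)
  qed
  then have "mixed_BV_modular \<Omega> p u \<le> liminf (\<lambda>n. Dirichlet (w n))"
    unfolding mixed_BV_modular_def using w(1) by (intro INF_lower) auto
  also have "\<dots> \<le> liminf (\<lambda>n. S + ennreal ((1 / real (Suc n)) powr P))"
    using w(3) by (intro Liminf_mono) auto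
  also have "(\<lambda>n. S + ennreal ((1 / real (Suc n)) powr P)) \<longlonglongrightarrow> S + ennreal (0 powr P)"
    using P_ge_1 lim0 by (intro tendsto_add tendsto_const tendsto_ennrealI tendsto_powr2) auto
  then have "liminf (\<lambda>n. S + ennreal ((1 / real (Suc n)) powr P)) = S"
    by (simp add: lim_imp_Liminf)
  finally show ?thesis .
qed

text \<open>Some approximating sequence has its lower limit below \<open>T\<close>. Infinitely many
  members then have energy below \<open>T\<close>, and all late members are close to
  \<open>u\<close>.\<close>

lemma mixed_BV_modular_lessD:
  assumes u: "u \<in> Lp_var \<Omega> p" and "mixed_BV_modular \<Omega> p u < T" "\<epsilon> > 0"
  obtains w where "w \<in> Lip_loc \<Omega>" "w \<in> Lp_var \<Omega> p"
    "\<rho> (\<lambda>x. w x - u x) \<le> ennreal \<epsilon>" "Dirichlet w < T"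
proof -
  obtain w where w: "\<And>i. w i \<in> Lip_loc \<Omega> \<inter> Lp_var \<Omega> p"
    "(\<lambda>i. luxemburg_norm \<Omega> p (\<lambda>x. w i x - u x)) \<longlonglongrightarrow> 0" "liminf (\<lambda>i. Dirichlet (w i)) < T"
    using assms(2) unfolding mixed_BV_modular_def INF_less_iff by auto
  have "\<not> (\<forall>\<^sub>F i in sequentially. T \<le> Dirichlet (w i))"
    using Liminf_bounded[of T "\<lambda>i. Dirichlet (w i)" sequentially] w(3) by auto
  then have freq: "\<exists>\<^sub>F i in sequentially. Dirichlet (w i) < T"
    by (simp add: frequently_def not_less)
  \<comment> \<open>The passage from norm to modular requires a bound of at most 1.\<close>
  have ev: "\<forall>\<^sub>F i in sequentially. luxemburg_norm \<Omega> p (\<lambda>x. w i x - u x) < min \<epsilon> 1"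
    using w(2) \<open>\<epsilon> > 0\<close> by (intro order_tendstoD) auto
  obtain i where i: "Dirichlet (w i) < T" "luxemburg_norm \<Omega> p (\<lambda>x. w i x - u x) < min \<epsilon> 1"
    using frequently_ex[OF frequently_eventually_frequently[OF freq ev]] by blast
  have "\<rho> (\<lambda>x. w i x - u x) \<le> ennreal (min \<epsilon> 1)"
    using i(2) w(1)[of i] u by (intro modular_le_of_luxemburg_norm_less Lp_var_diff) auto
  also have "\<dots> \<le> ennreal \<epsilon>"
    by (intro ennreal_leI) auto
  finally show thesis
    using that[of "w i"] w(1)[of i] i(1) by auto
qed

text \<open>The maximum of near-optimal approximants \<open>a\<close> and \<open>b\<close>
  approximates the maximum of \<open>u\<close> and \<open>v\<close>. Its gradient is almost
  everywhere that of \<open>a\<close> where \<open>b \<le> a\<close> and that of \<open>b\<close>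
  elsewhere, so the energies at most add up.\<close>

lemma mixed_BV_modular_max:
  assumes u: "u \<in> Lp_var \<Omega> p" and v: "v \<in> Lp_var \<Omega> p"
  shows "mixed_BV_modular \<Omega> p (\<lambda>x. max (u x) (v x)) \<le> mixed_BV_modular \<Omega> p u + mixed_BV_modular \<Omega> p v"
    (is "?L \<le> ?U + ?V")
proof (cases "?U = \<infinity> \<or> ?V = \<infinity>")
  case False
  then have fin: "?U < \<infinity>" "?V < \<infinity>" by (auto simp: less_top)
  show ?thesis
  proof (rule mixed_BV_modular_leI)
    show "(\<lambda>x. max (u x) (v x)) \<in> Lp_var \<Omega> p"
      using u v by (rule Lp_var_max)
    fix \<epsilon> :: real assume "\<epsilon> > 0"
    \<comment> \<open>Two errors \<delta> and the factor \<open>2 powr P\<close> of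
      \<open>modular_add_le\<close> together give \<epsilon>.\<close>
    define \<delta> where "\<delta> = \<epsilon> / (2 * 2 powr P)"
    have "\<delta> > 0" using \<open>\<epsilon> > 0\<close> by (simp add: \<delta>_def)
    have less: "T < T + ennreal (\<epsilon>/2)" if "T < \<infinity>" for T :: ennreal
      using that \<open>\<epsilon> > 0\<close> by (simp add: ennreal_less_add)
    obtain a where a: "a \<in> Lip_loc \<Omega>" "a \<in> Lp_var \<Omega> p"
        "\<rho> (\<lambda>x. a x - u x) \<le> ennreal \<delta>" "Dirichlet a < ?U + ennreal (\<epsilon>/2)"
      by (rule mixed_BV_modular_lessD[OF u less[OF fin(1)] \<open>\<delta> > 0\<close>])
    obtain b where b: "b \<in> Lip_loc \<Omega>" "b \<in> Lp_var \<Omega> p"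
        "\<rho> (\<lambda>x. b x - v x) \<le> ennreal \<delta>" "Dirichlet b < ?V + ennreal (\<epsilon>/2)"
      by (rule mixed_BV_modular_lessD[OF v less[OF fin(2)] \<open>\<delta> > 0\<close>])
    have [measurable]: "a \<in> borel_measurable M" "b \<in> borel_measurable M"
        "u \<in> borel_measurable M" "v \<in> borel_measurable M"
      using a b u v by (auto simp: Lp_var_iff)
    define w where "w x = max (a x) (b x)" for x
    have w: "w \<in> Lip_loc \<Omega>" "w \<in> Lp_var \<Omega> p"
      unfolding w_def[abs_def] using a b by (auto intro: Lip_loc_max Lp_var_max)
    have "\<rho> (\<lambda>x. w x - max (u x) (v x)) \<le> \<rho> (\<lambda>x. \<bar>a x - u x\<bar> + \<bar>b x - v x\<bar>)"
      unfolding w_def by (intro modular_mono AE_I2) linarith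
    also have "\<dots> \<le> ennreal (2 powr P) * (\<rho> (\<lambda>x. \<bar>a x - u x\<bar>) + \<rho> (\<lambda>x. \<bar>b x - v x\<bar>))"
      by (intro modular_add_le) measurable
    also have "\<dots> = ennreal (2 powr P) * (\<rho> (\<lambda>x. a x - u x) + \<rho> (\<lambda>x. b x - v x))"
      by (simp add: modular_def)
    also have "\<dots> \<le> ennreal (2 powr P) * (ennreal \<delta> + ennreal \<delta>)"
      using a b by (intro mult_left_mono add_mono) auto
    also have "\<dots> = ennreal \<epsilon>"
      using \<open>\<delta> > 0\<close> unfolding \<delta>_def
      by (simp add: ennreal_mult[symmetric] ennreal_plus[symmetric] del: ennreal_plus)
    finally have close: "\<rho> (\<lambda>x. w x - max (u x) (v x)) \<le> ennreal \<epsilon>" .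
    have "AE x in M. w x = a x \<longrightarrow> gradient w x = gradient a x"
         "AE x in M. w x = b x \<longrightarrow> gradient w x = gradient b x"
      using open_\<Omega> w a b by (auto intro: AE_gradient_eq_on_coincidence_set)
    note grad = this
    have "Dirichlet w \<le> Dirichlet a + Dirichlet b"
      unfolding modular_def
    proof (rule nn_integral_le_split[where A = "{x\<in>space M. b x \<le> a x}"])
      show "AE x in M. x \<in> {x\<in>space M. b x \<le> a x} \<longrightarrow>
          ennreal (\<bar>norm (gradient w x)\<bar> powr p x) \<le> ennreal (\<bar>norm (gradient a x)\<bar> powr p x)"
        using grad(1) by eventually_elim (auto simp: w_def max_def)
      show "AE x in M. x \<notin> {x\<in>space M. b x \<le> a x} \<longrightarrow>
          ennreal (\<bar>norm (gradient w x)\<bar> powr p x) \<le> ennreal (\<bar>norm (gradient b x)\<bar> powr p x)"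
        using grad(2) AE_space by eventually_elim (auto simp: w_def max_def)
    qed measurable
    also have "\<dots> \<le> (?U + ennreal (\<epsilon>/2)) + (?V + ennreal (\<epsilon>/2))"
      using a b by (intro add_mono) auto
    also have "\<dots> = ?U + ?V + (ennreal (\<epsilon>/2) + ennreal (\<epsilon>/2))"
      by (simp only: ac_simps)
    also have "ennreal (\<epsilon>/2) + ennreal (\<epsilon>/2) = ennreal \<epsilon>"
      using \<open>\<epsilon> > 0\<close> by (simp add: ennreal_plus[symmetric] del: ennreal_plus)
    finally show "\<exists>w. w \<in> Lip_loc \<Omega> \<inter> Lp_var \<Omega> p \<and>
        \<rho> (\<lambda>x. w x - max (u x) (v x)) \<le> ennreal \<epsilon> \<and> Dirichlet w \<le> ?U + ?V + ennreal \<epsilon>"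
      using w close by blast
  qed
qed auto

text \<open>Diagonal choice: a near-optimal approximant of some \<open>u k\<close> close to
  \<open>v\<close> is itself close to \<open>v\<close>, with energy barely above
  \<open>S\<close>.\<close>

lemma mixed_BV_modular_lower_semicontinuous:
  assumes u: "\<And>k. u k \<in> Lp_var \<Omega> p" and v: "v \<in> Lp_var \<Omega> p"
    and lim: "(\<lambda>k. \<rho> (\<lambda>x. u k x - v x)) \<longlonglongrightarrow> 0"
    and le: "\<And>k. mixed_BV_modular \<Omega> p (u k) \<le> S"
  shows "mixed_BV_modular \<Omega> p v \<le> S"
proof (cases "S = \<infinity>")
  case False
  then have "S < \<infinity>" by (simp add: less_top)
  show ?thesis
  proof (rule mixed_BV_modular_leI[OF v])
    fix \<epsilon> :: real assume "\<epsilon> > 0"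
    define \<delta> where "\<delta> = \<epsilon> / (2 * 2 powr P)"
    have "\<delta> > 0" using \<open>\<epsilon> > 0\<close> by (simp add: \<delta>_def)
    then have "\<forall>\<^sub>F k in sequentially. \<rho> (\<lambda>x. u k x - v x) < ennreal \<delta>"
      using lim by (intro order_tendstoD) auto
    then obtain k where k: "\<rho> (\<lambda>x. u k x - v x) < ennreal \<delta>"
      by (auto simp: eventually_sequentially)
    have "S < S + ennreal \<epsilon>"
      using \<open>S < \<infinity>\<close> \<open>\<epsilon> > 0\<close> by (simp add: ennreal_less_add)
    with le have "mixed_BV_modular \<Omega> p (u k) < S + ennreal \<epsilon>"
      by (rule le_less_trans)
    then obtain w where w: "w \<in> Lip_loc \<Omega>" "w \<in> Lp_var \<Omega> p"
        "\<rho> (\<lambda>x. w x - u k x) \<le> ennreal \<delta>" "Dirichlet w < S + ennreal \<epsilon>"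
      by (rule mixed_BV_modular_lessD[OF u _ \<open>\<delta> > 0\<close>])
    have [measurable]: "u k \<in> borel_measurable M" "v \<in> borel_measurable M" "w \<in> borel_measurable M"
      using w u v by (auto simp: Lp_var_iff)
    have "\<rho> (\<lambda>x. w x - v x) = \<rho> (\<lambda>x. (w x - u k x) + (u k x - v x))"
      by simp
    also have "\<dots> \<le> ennreal (2 powr P) * (\<rho> (\<lambda>x. w x - u k x) + \<rho> (\<lambda>x. u k x - v x))"
      by (intro modular_add_le) measurable
    also have "\<dots> \<le> ennreal (2 powr P) * (ennreal \<delta> + ennreal \<delta>)"
      using w k by (intro mult_left_mono add_mono) auto
    also have "\<dots> = ennreal \<epsilon>"
      using \<open>\<delta> > 0\<close> unfolding \<delta>_def
      by (simp add: ennreal_mult[symmetric] ennreal_plus[symmetric] del: ennreal_plus)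
    finally show "\<exists>w. w \<in> Lip_loc \<Omega> \<inter> Lp_var \<Omega> p \<and>
        \<rho> (\<lambda>x. w x - v x) \<le> ennreal \<epsilon> \<and> Dirichlet w \<le> S + ennreal \<epsilon>"
      using w by (intro exI[of _ w]) auto
  qed
qed simp

section \<open>The zero function and the capacity of the empty set\<close>

lemma
  shows zero_in_Lp_var: "(\<lambda>_. 0) \<in> Lp_var \<Omega> p"
    and modular_zero: "\<rho> (\<lambda>_. 0) = 0"
  by (auto simp: Lp_var_iff modular_def)

lemma mixed_BV_modular_zero: "mixed_BV_modular \<Omega> p (\<lambda>_. 0) = 0"
proof -
  have "gradient (\<lambda>_. 0::real) x = 0" for x :: 'a
    by (rule gradient_eqI) (rule GDERIV_const)
  moreover have "(\<lambda>_. 0) \<in> Lip_loc \<Omega>"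
    unfolding Lip_loc_def lipschitz_on_def by (auto intro!: exI[of _ 1])
  ultimately have "mixed_BV_modular \<Omega> p (\<lambda>_. 0) \<le> 0"
    using zero_in_Lp_var
    by (intro mixed_BV_modular_leI exI[of _ "\<lambda>_. 0"]) (auto simp: modular_zero)
  then show ?thesis by simp
qed

text \<open>The zero function competes, with the empty set as the open neighbourhood.\<close>

lemma mixed_capacity_empty: "mixed_capacity \<Omega> p {} = 0"
proof -
  have "(\<lambda>_. 0) \<in> mixed_admissible \<Omega> p {}"
    using zero_in_Lp_var
    by (auto simp: mixed_admissible_def mixed_BV_def mixed_BV_modular_zero
        intro!: exI[of _ "{}"] AE_I2)
  then have "mixed_capacity \<Omega> p {} \<le> \<rho> (\<lambda>_. 0) + mixed_BV_modular \<Omega> p (\<lambda>_. 0)"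
    unfolding mixed_capacity_def by (rule INF_lower)
  then show ?thesis by (simp add: modular_zero mixed_BV_modular_zero)
qed

section \<open>Finite maxima and countable subadditivity\<close>

text \<open>Starting from 0 gives inductions a base case with vanishing modulars; where the
  \<open>u i\<close> are nonnegative, a nonempty maximum does not change.\<close>

primrec finite_max :: "(nat \<Rightarrow> 'a \<Rightarrow> real) \<Rightarrow> nat \<Rightarrow> 'a \<Rightarrow> real" where
  "finite_max u 0 = (\<lambda>_. 0)"
| "finite_max u (Suc k) = (\<lambda>x. max (finite_max u k x) (u k x))"

lemma finite_max_Lp_var:
  assumes "\<And>i. u i \<in> Lp_var \<Omega> p"
  shows "finite_max u k \<in> Lp_var \<Omega> p"
  by (induction k) (auto simp: zero_in_Lp_var assms intro: Lp_var_max)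

lemma mixed_BV_modular_finite_max:
  assumes "\<And>i. u i \<in> Lp_var \<Omega> p"
  shows "mixed_BV_modular \<Omega> p (finite_max u k) \<le> (\<Sum>i<k. mixed_BV_modular \<Omega> p (u i))"
proof (induction k)
  case (Suc k)
  have "mixed_BV_modular \<Omega> p (finite_max u (Suc k)) \<le>
      mixed_BV_modular \<Omega> p (finite_max u k) + mixed_BV_modular \<Omega> p (u k)"
    using mixed_BV_modular_max[OF finite_max_Lp_var[OF assms] assms] by simp
  also have "\<dots> \<le> (\<Sum>i<Suc k. mixed_BV_modular \<Omega> p (u i))"
    using Suc by (simp add: add_right_mono)
  finally show ?case .
qed (simp add: mixed_BV_modular_zero)

lemma finite_max_upper: "i < k \<Longrightarrow> u i x \<le> finite_max u k x"
  by (induction k) (auto simp: less_Suc_eq le_max_iff_disj)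

lemma finite_max_nonneg: "0 \<le> finite_max u k x"
  by (induction k) (auto simp: le_max_iff_disj)

lemma finite_max_le_1: "(\<And>i. u i x \<le> 1) \<Longrightarrow> finite_max u k x \<le> 1"
  by (induction k) auto

lemma incseq_finite_max: "incseq (\<lambda>k. finite_max u k x)"
  by (rule incseq_SucI) simp

lemma finite_max_cases: "finite_max u k x = 0 \<or> (\<exists>i. finite_max u k x = u i x)"
  by (induction k) (auto simp: max_def)

lemma mixed_capacity_countably_subadditive:
  fixes E :: "nat \<Rightarrow> 'a set"
  shows "mixed_capacity \<Omega> p (\<Union>i. E i) \<le> (\<Sum>i. mixed_capacity \<Omega> p (E i))"
proof (rule ennreal_le_epsilon)
  fix \<epsilon> :: real assume fin: "(\<Sum>i. mixed_capacity \<Omega> p (E i)) < top" and "0 < \<epsilon>"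
  \<comment> \<open>The errors sum to \<epsilon>. Finiteness of the series makes each capacity
    finite, so that adding an error is a strict increase.\<close>
  have "\<exists>u \<in> mixed_admissible \<Omega> p (E i). \<rho> u + mixed_BV_modular \<Omega> p u <
      mixed_capacity \<Omega> p (E i) + ennreal (\<epsilon> * (1/2) ^ Suc i)" for i
  proof -
    have "mixed_capacity \<Omega> p (E i) < \<infinity>"
      using fin by (metis ennreal_suminf_lessD infinity_ennreal_def)
    then have "mixed_capacity \<Omega> p (E i) < mixed_capacity \<Omega> p (E i) + ennreal (\<epsilon> * (1/2) ^ Suc i)"
      using \<open>0 < \<epsilon>\<close> by (simp add: ennreal_less_add)
    then show ?thesis
      unfolding mixed_capacity_def[of \<Omega> p "E i"] INF_less_iff .
  qed
  then obtain u where adm: "\<And>i. u i \<in> mixed_admissible \<Omega> p (E i)" and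
    u: "\<And>i. \<rho> (u i) + mixed_BV_modular \<Omega> p (u i) < mixed_capacity \<Omega> p (E i) + ennreal (\<epsilon> * (1/2) ^ Suc i)"
    by metis
  have Lp: "u i \<in> Lp_var \<Omega> p" for i
    using adm[of i] by (simp add: mixed_admissible_def mixed_BV_def)
  have [measurable]: "u i \<in> borel_measurable M" "finite_max u i \<in> borel_measurable M" for i
    using Lp finite_max_Lp_var[of u] by (auto simp: Lp_var_iff)
  have "\<forall>i. \<exists>U. open U \<and> E i \<subseteq> U \<and> U \<subseteq> \<Omega> \<and> (AE x in lebesgue_on U. u i x = 1)"
    using adm by (simp add: mixed_admissible_def)
  then obtain U where U: "\<And>i. open (U i)" "\<And>i. E i \<subseteq> U i" "\<And>i. U i \<subseteq> \<Omega>"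
    "\<And>i. AE x in lebesgue_on (U i). u i x = 1"
    by metis
  have bounds: "AE x in M. \<forall>i. 0 \<le> u i x \<and> u i x \<le> 1"
    unfolding AE_all_countable using adm by (simp add: mixed_admissible_def)

  \<comment> \<open>The pointwise supremum wherever \<open>bounds\<close> holds. Writing it as
    \<open>lim\<close> gives measurability on all of \<Omega>; the values on the exceptional null
    set are arbitrary.\<close>
  define v where "v x = lim (\<lambda>k. finite_max u k x)" for x
  have [measurable]: "v \<in> borel_measurable M"
    unfolding v_def by measurable
  have v: "(\<lambda>k. finite_max u k x) \<longlonglongrightarrow> v x" "\<And>k. finite_max u k x \<le> v x" "v x \<le> 1"
    if "\<forall>i. 0 \<le> u i x \<and> u i x \<le> 1" for x
  proof -
    have "convergent (\<lambda>k. finite_max u k x)"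
      using that finite_max_le_1[of u x] finite_max_nonneg[of u _ x]
      by (intro Bseq_mono_convergent BseqI'[of _ 1]) (auto intro: incseq_finite_max[THEN incseqD])
    then show lim: "(\<lambda>k. finite_max u k x) \<longlonglongrightarrow> v x"
      unfolding v_def by (simp add: convergent_LIMSEQ_iff)
    show "finite_max u k x \<le> v x" for k
      using lim incseq_finite_max by (rule incseq_le[rotated])
    show "v x \<le> 1"
      using lim that by (intro LIMSEQ_le_const2[OF lim]) (auto intro: finite_max_le_1)
  qed
  define W where "W x = (\<Sum>i. ennreal (\<bar>u i x\<bar> powr p x))" for x
  have [measurable]: "W \<in> borel_measurable M"
    unfolding W_def by measurable
  have W_int: "(\<integral>\<^sup>+x. W x \<partial>M) = (\<Sum>i. \<rho> (u i))"
    unfolding W_def modular_def by (intro nn_integral_suminf) measurable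
  have v_le: "AE x in M. ennreal (\<bar>v x\<bar> powr p x) \<le> W x"
    using bounds AE_exponent
  proof eventually_elim
    case (elim x)
    \<comment> \<open>A finite maximum is 0 or one of the \<open>u i x\<close>, so its power is 0 or
      a single term of the series.\<close>
    have le: "ennreal (\<bar>finite_max u k x\<bar> powr p x) \<le> W x" for k
      using finite_max_cases[of u k x] elim
        ennreal_le_suminf[of "\<lambda>i. ennreal (\<bar>u i x\<bar> powr p x)"] unfolding W_def by auto
    have "(\<lambda>k. ennreal (\<bar>finite_max u k x\<bar> powr p x)) \<longlonglongrightarrow> ennreal (\<bar>v x\<bar> powr p x)"
      using v(1)[OF elim(1)] elim by (intro tendsto_ennrealI tendsto_powr2 tendsto_rabs) auto
    then show ?case
      by (rule LIMSEQ_le_const2) (use le in blast)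
  qed
  have sum_le: "(\<Sum>i. \<rho> (u i)) + (\<Sum>i. mixed_BV_modular \<Omega> p (u i)) \<le> (\<Sum>i. mixed_capacity \<Omega> p (E i)) + ennreal \<epsilon>"
  proof -
    have "(\<Sum>i. \<rho> (u i)) + (\<Sum>i. mixed_BV_modular \<Omega> p (u i)) = (\<Sum>i. \<rho> (u i) + mixed_BV_modular \<Omega> p (u i))"
      by (rule suminf_add) auto
    also have "\<dots> \<le> (\<Sum>i. mixed_capacity \<Omega> p (E i) + ennreal (\<epsilon> * (1/2) ^ Suc i))"
      using u by (intro suminf_le) (auto intro: less_imp_le)
    also have "\<dots> = (\<Sum>i. mixed_capacity \<Omega> p (E i)) + (\<Sum>i. ennreal (\<epsilon> * (1/2) ^ Suc i))"
      by (rule suminf_add[symmetric]) auto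
    also have "(\<lambda>i. \<epsilon> * (1/2) ^ Suc i) sums (\<epsilon> * 1)"
      by (intro sums_mult power_half_series)
    then have "(\<Sum>i. ennreal (\<epsilon> * (1/2) ^ Suc i)) = ennreal \<epsilon>"
      using \<open>0 < \<epsilon>\<close> by (subst suminf_ennreal2) (auto simp: sums_iff)
    finally show ?thesis .
  qed
  also have "\<dots> < \<infinity>"
    using fin by simp
  finally have fin_sum: "(\<Sum>i. \<rho> (u i)) < \<infinity>" "(\<Sum>i. mixed_BV_modular \<Omega> p (u i)) < \<infinity>"
    by auto
  have v_modular: "\<rho> v \<le> (\<Sum>i. \<rho> (u i))"
    unfolding W_int[symmetric] unfolding modular_def using v_le by (rule nn_integral_mono_AE)
  have v_Lp: "v \<in> Lp_var \<Omega> p"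
    using v_modular fin_sum(1) by (auto simp: Lp_var_iff intro: le_less_trans)
  have "(\<lambda>k. \<rho> (\<lambda>x. finite_max u k x - v x)) \<longlonglongrightarrow> (\<integral>\<^sup>+x. 0 \<partial>M)"
    unfolding modular_def
  proof (rule nn_integral_dominated_convergence[where w = W])
    show "AE x in M. ennreal (\<bar>finite_max u k x - v x\<bar> powr p x) \<le> W x" for k
      using bounds AE_exponent v_le
    proof eventually_elim
      case (elim x)
      \<comment> \<open>The finite maximum lies between 0 and \<open>v x\<close>, so the power of
        \<open>v x\<close>, and with it \<open>W x\<close>, dominates.\<close>
      have "\<bar>finite_max u k x - v x\<bar> \<le> \<bar>v x\<bar>"
        using v(2)[OF elim(1), of k] finite_max_nonneg[of u k x] by linarith
      then have "ennreal (\<bar>finite_max u k x - v x\<bar> powr p x) \<le> ennreal (\<bar>v x\<bar> powr p x)"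
        using elim by (intro ennreal_leI powr_mono2) auto
      then show ?case
        using elim(3) by (rule order_trans)
    qed
    show "AE x in M. (\<lambda>k. ennreal (\<bar>finite_max u k x - v x\<bar> powr p x)) \<longlonglongrightarrow> 0"
      using bounds AE_exponent
    proof eventually_elim
      case (elim x)
      have "(\<lambda>k. \<bar>finite_max u k x - v x\<bar>) \<longlonglongrightarrow> \<bar>v x - v x\<bar>"
        using v(1)[OF elim(1)] by (intro tendsto_rabs tendsto_diff tendsto_const)
      then have "(\<lambda>k. ennreal (\<bar>finite_max u k x - v x\<bar> powr p x)) \<longlonglongrightarrow> ennreal (\<bar>v x - v x\<bar> powr p x)"
        using elim by (intro tendsto_ennrealI tendsto_powr2) auto
      then show ?case by simp
    qed
  qed (use W_int fin_sum in simp_all)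
  then have lim: "(\<lambda>k. \<rho> (\<lambda>x. finite_max u k x - v x)) \<longlonglongrightarrow> 0"
    by simp
  have v_BV: "mixed_BV_modular \<Omega> p v \<le> (\<Sum>i. mixed_BV_modular \<Omega> p (u i))"
  proof (rule mixed_BV_modular_lower_semicontinuous[OF finite_max_Lp_var[OF Lp] v_Lp lim])
    show "mixed_BV_modular \<Omega> p (finite_max u k) \<le> (\<Sum>i. mixed_BV_modular \<Omega> p (u i))" for k
      by (rule order_trans[OF mixed_BV_modular_finite_max[OF Lp]]) (rule sum_le_suminf; simp)
  qed
  have "v \<in> mixed_admissible \<Omega> p (\<Union>i. E i)"
    unfolding mixed_admissible_def mixed_BV_def
  proof (safe intro!: exI[of _ "\<Union>i. U i"])
    show "v \<in> Lp_var \<Omega> p" by (rule v_Lp)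
    show "mixed_BV_modular \<Omega> p v < \<infinity>"
      using v_BV fin_sum(2) by (rule le_less_trans)
    show "AE x in M. 0 \<le> v x \<and> v x \<le> 1"
      using bounds
    proof eventually_elim
      case (elim x)
      then show ?case
        using v(2)[OF elim, of 0] v(3)[OF elim] by simp
    qed
    \<comment> \<open>The exceptional sets for the different \<open>U i\<close> become null sets of
      one measure, so that countably many can be combined.\<close>
    have "AE x in lebesgue. \<forall>i. x \<in> U i \<longrightarrow> u i x = 1"
      unfolding AE_all_countable using U(1,4) by (simp add: AE_restrict_space_iff)
    moreover have "AE x in lebesgue. x \<in> \<Omega> \<longrightarrow> (\<forall>i. 0 \<le> u i x \<and> u i x \<le> 1)"
      using bounds open_\<Omega> by (simp add: AE_restrict_space_iff)
    ultimately have "AE x in lebesgue. x \<in> (\<Union>i. U i) \<longrightarrow> v x = 1"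
    proof eventually_elim
      case (elim x)
      show ?case
      proof
        assume "x \<in> (\<Union>i. U i)"
        then obtain i where i: "x \<in> U i" by blast
        then have b: "\<forall>i. 0 \<le> u i x \<and> u i x \<le> 1"
          using elim U(3) by blast
        \<comment> \<open>\<open>finite_max u k\<close> involves only indices below
          \<open>k\<close>, hence \<open>Suc i\<close>.\<close>
        have "1 \<le> finite_max u (Suc i) x"
          using finite_max_upper[of i "Suc i" u x] elim(1) i by simp
        then show "v x = 1"
          using v(2)[OF b, of "Suc i"] v(3)[OF b] by linarith
      qed
    qed
    then show "AE x in lebesgue_on (\<Union>i. U i). v x = 1"
      using U(1) by (subst AE_restrict_space_iff) auto
  qed (use U(1) subsetD[OF U(2)] subsetD[OF U(3)] in auto)
  then have "mixed_capacity \<Omega> p (\<Union>i. E i) \<le> \<rho> v + mixed_BV_modular \<Omega> p v"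
    unfolding mixed_capacity_def by (rule INF_lower)
  then show "mixed_capacity \<Omega> p (\<Union>i. E i) \<le> (\<Sum>i. mixed_capacity \<Omega> p (E i)) + ennreal \<epsilon>"
    using v_modular v_BV sum_le by (meson add_mono order_trans)
qed

end

section \<open>Monotonicity and the outer measure property\<close>

lemma mixed_capacity_mono:
  assumes "E \<subseteq> F"
  shows "mixed_capacity \<Omega> p E \<le> mixed_capacity \<Omega> p F"
proof -
  have "mixed_admissible \<Omega> p F \<subseteq> mixed_admissible \<Omega> p E"
    using assms unfolding mixed_admissible_def by blast
  then show ?thesis
    unfolding mixed_capacity_def by (rule INF_superset_mono) simp
qed

theorem theorem5p2:
  fixes \<Omega> :: "(real ^ 'n) set" and p :: "real ^ 'n \<Rightarrow> real"
  assumes "open \<Omega>"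
    and "p \<in> borel_measurable (lebesgue_on \<Omega>)"
    and "\<forall>x\<in>\<Omega>. 1 \<le> p x"
    and "esssup (lebesgue_on \<Omega>) (\<lambda>x. ereal (p x)) < \<infinity>"
  shows "mixed_capacity \<Omega> p {} = 0 \<and>
    (\<forall>E F. E \<subseteq> F \<and> F \<subseteq> \<Omega> \<longrightarrow> mixed_capacity \<Omega> p E \<le> mixed_capacity \<Omega> p F) \<and>
    (\<forall>E :: nat \<Rightarrow> (real ^ 'n) set. (\<forall>i. E i \<subseteq> \<Omega>) \<longrightarrow>
       mixed_capacity \<Omega> p (\<Union>i. E i) \<le> (\<Sum>i. mixed_capacity \<Omega> p (E i)))"
proof -
  \<comment> \<open>The essential supremum is \<open>-\<infinity>\<close> when \<Omega> is empty, so
    a real upper bound replaces its value; the maximum with 1 below ensures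
    \<open>P_ge_1\<close>.\<close>
  obtain n :: nat where "esssup (lebesgue_on \<Omega>) (\<lambda>x. ereal (p x)) < ereal (real n)"
    using assms(4) less_PInf_Ex_of_nat[of "esssup (lebesgue_on \<Omega>) (\<lambda>x. ereal (p x))"] by auto
  then obtain Q where Q: "esssup (lebesgue_on \<Omega>) (\<lambda>x. ereal (p x)) \<le> ereal Q"
    using less_imp_le by blast
  have "AE x in lebesgue_on \<Omega>. p x \<le> max 1 Q"
    using esssup_AE[where M = "lebesgue_on \<Omega>" and f = "\<lambda>x. ereal (p x)"]
  proof eventually_elim
    case (elim x)
    with Q have "ereal (p x) \<le> ereal Q" by (rule order_trans[rotated])
    then show ?case by simp
  qed
  then interpret bounded_exponent \<Omega> p "max 1 Q"
    using assms by unfold_locales auto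
  show ?thesis
    by (simp add: mixed_capacity_empty mixed_capacity_mono mixed_capacity_countably_subadditive)
qed

end
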